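(* Let $\{c_n\}_{n\ge 1}$ be a sequence of positive numbers, and let $\{X_{n,j},\ 1\le j\le k_n,\ n\ge 1\}$ be an array of random variables satisfying the maximal inequality (M) (stated in the context) for sequences $\{\alpha_n\}$, $\{\beta_n\}$ of nonnegative numbers such that $\alpha_n=O(1)$ and $\beta_n=O(1)$ as $n\to\infty$. Suppose that (i') for all $\lambda>0$, $\sum_{n=1}^{\infty} c_n\sum_{j=1}^{k_n}\mathbb{P}\{|X_{n,j}|>\lambda\}<\infty$; (ii') there exist $\delta>0$ and $q\ge 1$ such that $\sum_{n=1}^{\infty} c_n\Big(\sum_{j=1}^{k_n}\mathbb{V}\big(X_{n,j}I_{\{|X_{n,j}|\le\delta\}}\big)\Big)^{q}<\infty$. Then, for all $\varepsilon>0$ (and with $\delta$ as in (ii')), $$\sum_{n=1}^{\infty} c_n\,\mathbb{P}\Big\{\max_{1\le i\le k_n}\Big|\sum_{j=1}^{i}\big(X_{n,j}-\mathbb{E}\,X_{n,j}I_{\{|X_{n,j}|\le\delta\}}\big)\Big|>\varepsilon\Big\}<\infty .$$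
   Context: $\{k_n\}_{n\ge1}$ is a sequence of positive integers with $k_n\to\infty$ as $n\to\infty$. $I_A$ is the indicator random variable of the event $A$; $\mathbb{V}$ denotes variance. For $\ell>0$, $g_\ell(x)=\max(\min(x,\ell),-\ell)$ is the truncation at level $\ell$. Inequality (M): an array $\{X_{n,j},\ 1\le j\le k_n,\ n\ge1\}$ of random variables satisfies (M) for sequences $\{\alpha_n\}$, $\{\beta_n\}$ of nonnegative numbers if there exist constants $C_1,C_2>0$, not depending on $n,\ell,\lambda,\eta$, such that for each $n\ge1$ and all $\ell,\lambda,\eta>0$, $$\mathbb{P}\Big\{\max_{1\le i\le k_n}\Big|\sum_{j=1}^{i}[g_\ell(X_{n,j})-\mathbb{E}g_\ell(X_{n,j})]\Big|\ge\lambda\Big\}\le \alpha_n\,\mathbb{P}\Big\{\max_{1\le j\le k_n}|g_\ell(X_{n,j})-\mathbb{E}g_\ell(X_{n,j})|>C_1\eta\Big\}+\beta_n\Big\{\frac{\sum_{j=1}^{k_n}\mathbb{E}[g_\ell(X_{n,j})-\mathbb{E}g_\ell(X_{n,j})]^2}{C_2\lambda\eta}\Big\}^{\lambda/\eta}.$$ *)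

theory Defs
  imports "HOL-Probability.Probability" "HOL-Library.Landau_Symbols"
begin

definition trunc :: "real \<Rightarrow> real \<Rightarrow> real" where
  "trunc l x = max (min x l) (- l)"

text \<open>Unlike \<^const>\<open>trunc\<close>, the following cuts large values off to zero: it is
  \<open>Y I\<^sub>A\<close> for the event \<open>A = {\<bar>Y\<bar> \<le> d}\<close>.\<close>

definition cutoff :: "real \<Rightarrow> ('a \<Rightarrow> real) \<Rightarrow> 'a \<Rightarrow> real" where
  "cutoff d Y \<omega> = Y \<omega> * indicator {\<omega>. \<bar>Y \<omega>\<bar> \<le> d} \<omega>"

definition centered_trunc :: "'a measure \<Rightarrow> real \<Rightarrow> ('a \<Rightarrow> real) \<Rightarrow> 'a \<Rightarrow> real" where
  "centered_trunc M l Y \<omega> = trunc l (Y \<omega>) - prob_space.expectation M (\<lambda>\<omega>. trunc l (Y \<omega>))"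

text \<open>The base of the power below is nonnegative. Since \<open>0 powr a = 0\<close> and the exponent
  is positive, \<open>powr\<close> is the usual power also when the base vanishes.\<close>

definition maximal_inequality ::
  "'a measure \<Rightarrow> (nat \<Rightarrow> nat) \<Rightarrow> (nat \<Rightarrow> nat \<Rightarrow> 'a \<Rightarrow> real) \<Rightarrow> (nat \<Rightarrow> real) \<Rightarrow> (nat \<Rightarrow> real) \<Rightarrow> bool"
where
  "maximal_inequality M k X \<alpha> \<beta> \<longleftrightarrow>
    (\<exists>C1>0. \<exists>C2>0. \<forall>n\<ge>1. \<forall>l>0. \<forall>s>0. \<forall>\<eta>>0.
      \<P>(\<omega> in M. (MAX i\<in>{1..k n}. \<bar>\<Sum>j=1..i. centered_trunc M l (X n j) \<omega>\<bar>) \<ge> s)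
      \<le> \<alpha> n * \<P>(\<omega> in M. (MAX j\<in>{1..k n}. \<bar>centered_trunc M l (X n j) \<omega>\<bar>) > C1 * \<eta>)
        + \<beta> n * ((\<Sum>j=1..k n. prob_space.expectation M (\<lambda>\<omega>. (centered_trunc M l (X n j) \<omega>)\<^sup>2))
                  / (C2 * s * \<eta>)) powr (s / \<eta>))"

end

theory Submission
  imports Defs
begin

text \<open>
  Write \<open>a\<^sub>n(u)\<close> for the total tail \<open>\<Sum>\<^sub>j P(\<bar>X\<^sub>n\<^sub>j\<bar> > u)\<close> of the \<open>n\<close>-th row and \<open>v\<^sub>n\<close> for the sum of the
  variances of its cutoffs at \<open>\<delta>\<close>. Both \<open>\<Sum> c\<^sub>n a\<^sub>n(u)\<close> and \<open>\<Sum> c\<^sub>n v\<^sub>n\<^sup>q\<close> converge, so it suffices to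
  bound the probability \<open>p\<^sub>n\<close> in question by a constant multiple of \<open>a\<^sub>n(u) + v\<^sub>n\<^sup>q\<close>, for one
  suitable \<open>u\<close> and uniformly in \<open>n\<close>.

  Rows with \<open>a\<^sub>n(u) > \<theta>\<close> satisfy this trivially because \<open>p\<^sub>n \<le> 1 \<le> a\<^sub>n(u) / \<theta>\<close>. Hence \<open>a\<^sub>n(u)\<close> may be
  assumed as small as needed, although neither it nor any single tail probability is known to
  tend to zero (the weights \<open>c\<^sub>n\<close> may be small).

  In the remaining rows, replace every \<open>X\<^sub>n\<^sub>j\<close> by its truncation at \<open>\<delta>\<close>. The variables change with
  probability at most \<open>a\<^sub>n(u)\<close>, and the change of the centering constants is at most
  \<open>\<delta> a\<^sub>n(u) \<le> \<epsilon>/2\<close> in total (\<open>prob_max_partial_sums_le\<close>). The maximal inequality with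
  \<open>\<lambda> = \<epsilon>/2\<close> and \<open>\<eta> = \<lambda>/q\<close> bounds what is left by two terms. The choice of \<open>\<eta>\<close> makes the exponent
  in the second equal to \<open>q\<close>; as the variances of truncation and cutoff differ by tail
  probabilities (\<open>second_moment_centered_trunc_le\<close>), this term is of order
  \<open>v\<^sub>n\<^sup>q + a\<^sub>n(u)\<^sup>q \<le> v\<^sub>n\<^sup>q + a\<^sub>n(u)\<close>. In the first term the level \<open>C\<^sub>1 \<eta>\<close> is fixed, while the means of
  the truncations are small because \<open>a\<^sub>n(u)\<close> is, so the term is again of order \<open>a\<^sub>n(u)\<close> if
  \<open>3 u \<le> C\<^sub>1 \<eta>\<close> (\<open>prob_max_centered_trunc_le\<close>).
\<close>

section \<open>Truncation of a single random variable\<close>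

lemma measurable_trunc [measurable]: "trunc l \<in> borel_measurable borel"
  unfolding trunc_def by measurable

lemma measurable_cutoff [measurable]:
  assumes [measurable]: "Y \<in> borel_measurable M"
  shows "cutoff d Y \<in> borel_measurable M"
proof -
  have "cutoff d Y = (\<lambda>\<omega>. if \<bar>Y \<omega>\<bar> \<le> d then Y \<omega> else 0)"
    by (auto simp: cutoff_def fun_eq_iff)
  then show ?thesis by simp
qed

lemma abs_trunc_le: "l > 0 \<Longrightarrow> \<bar>trunc l x\<bar> \<le> l"
  by (auto simp: trunc_def)

lemma abs_trunc_le_abs: "l > 0 \<Longrightarrow> \<bar>trunc l x\<bar> \<le> \<bar>x\<bar>"
  by (auto simp: trunc_def)

lemma trunc_eq_self: "\<bar>x\<bar> \<le> l \<Longrightarrow> trunc l x = x"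
  by (auto simp: trunc_def)

lemma abs_cutoff_le: "d > 0 \<Longrightarrow> \<bar>cutoff d Y \<omega>\<bar> \<le> d"
  by (auto simp: cutoff_def indicator_def)

text \<open>The maximal inequality speaks of truncations, the variance condition of cutoffs. The two
  differ only where \<open>\<bar>Y\<bar> > d\<close>, and there by exactly \<open>d\<close>, so that every discrepancy between
  them is paid for by a tail probability.\<close>

lemma abs_trunc_minus_cutoff:
  "d > 0 \<Longrightarrow> \<bar>trunc d (Y \<omega>) - cutoff d Y \<omega>\<bar> = d * indicator {\<omega>. \<bar>Y \<omega>\<bar> > d} \<omega>"
  by (auto simp: trunc_def cutoff_def indicator_def)

context prob_space
begin

lemma integrable_trunc:
  assumes [measurable]: "Y \<in> borel_measurable M" and "l > 0"
  shows "integrable M (\<lambda>\<omega>. trunc l (Y \<omega>))"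
  by (rule integrable_const_bound[where B = l]) (use assms abs_trunc_le in auto)

lemma integrable_cutoff:
  assumes [measurable]: "Y \<in> borel_measurable M" and "d > 0"
  shows "integrable M (cutoff d Y)"
  by (rule integrable_const_bound[where B = d]) (use assms in \<open>auto simp: abs_cutoff_le\<close>)

lemma measurable_centered_trunc [measurable]:
  assumes [measurable]: "Y \<in> borel_measurable M"
  shows "centered_trunc M l Y \<in> borel_measurable M"
  unfolding centered_trunc_def[abs_def] by measurable

lemma expectation_scaled_tail_indicator:
  fixes Y :: "'a \<Rightarrow> real"
  assumes [measurable]: "Y \<in> borel_measurable M"
  shows "expectation (\<lambda>\<omega>. b * indicator {\<omega>. \<bar>Y \<omega>\<bar> > t} \<omega>) = b * \<P>(\<omega> in M. \<bar>Y \<omega>\<bar> > t)"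
    and "integrable M (\<lambda>\<omega>. b * indicator {\<omega>. \<bar>Y \<omega>\<bar> > t} \<omega> :: real)"
proof -
  have eq: "indicator {\<omega>. \<bar>Y \<omega>\<bar> > t} \<omega> = (indicator {\<omega> \<in> space M. \<bar>Y \<omega>\<bar> > t} \<omega> :: real)"
    if "\<omega> \<in> space M" for \<omega>
    using that by (auto simp: indicator_def)
  show "expectation (\<lambda>\<omega>. b * indicator {\<omega>. \<bar>Y \<omega>\<bar> > t} \<omega>) = b * \<P>(\<omega> in M. \<bar>Y \<omega>\<bar> > t)"
    by (subst Bochner_Integration.integral_cong[OF refl, 
          where g = "\<lambda>\<omega>. b * indicator {\<omega> \<in> space M. \<bar>Y \<omega>\<bar> > t} \<omega>"])
       (auto simp: eq)
  show "integrable M (\<lambda>\<omega>. b * indicator {\<omega>. \<bar>Y \<omega>\<bar> > t} \<omega> :: real)"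
    by (subst Bochner_Integration.integrable_cong[OF refl, 
          where g = "\<lambda>\<omega>. b * indicator {\<omega> \<in> space M. \<bar>Y \<omega>\<bar> > t} \<omega>"])
       (auto simp: eq integrable_real_indicator less_top[symmetric])
qed

lemma expectation_trunc_minus_cutoff:
  assumes Y [measurable]: "Y \<in> borel_measurable M" and "d > 0"
  shows "\<bar>expectation (\<lambda>\<omega>. trunc d (Y \<omega>)) - expectation (cutoff d Y)\<bar>
    \<le> d * \<P>(\<omega> in M. \<bar>Y \<omega>\<bar> > d)"
proof -
  have "\<bar>expectation (\<lambda>\<omega>. trunc d (Y \<omega>)) - expectation (cutoff d Y)\<bar>
      = \<bar>expectation (\<lambda>\<omega>. trunc d (Y \<omega>) - cutoff d Y \<omega>)\<bar>"
    by (simp add: Bochner_Integration.integral_diff integrable_trunc integrable_cutoff assms)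
  also have "\<dots> \<le> expectation (\<lambda>\<omega>. \<bar>trunc d (Y \<omega>) - cutoff d Y \<omega>\<bar>)"
    using integral_norm_bound[of M "\<lambda>\<omega>. trunc d (Y \<omega>) - cutoff d Y \<omega>"] by simp
  also have "\<dots> = d * \<P>(\<omega> in M. \<bar>Y \<omega>\<bar> > d)"
    using assms by (simp only: abs_trunc_minus_cutoff expectation_scaled_tail_indicator)
  finally show ?thesis .
qed

text \<open>Splitting at a level \<open>t\<close> of its own, unrelated to \<open>d\<close>, shows that the mean of the truncation
  is small as soon as the tail at \<open>t\<close> is: this makes centering harmless in the first term of
  the maximal inequality.\<close>

lemma abs_expectation_trunc_le:
  assumes Y [measurable]: "Y \<in> borel_measurable M" and "d > 0" "t \<ge> 0"
  shows "\<bar>expectation (\<lambda>\<omega>. trunc d (Y \<omega>))\<bar> \<le> t + d * \<P>(\<omega> in M. \<bar>Y \<omega>\<bar> > t)"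
proof -
  have "\<bar>expectation (\<lambda>\<omega>. trunc d (Y \<omega>))\<bar> \<le> expectation (\<lambda>\<omega>. \<bar>trunc d (Y \<omega>)\<bar>)"
    using integral_norm_bound[of M "\<lambda>\<omega>. trunc d (Y \<omega>)"] by simp
  also have "\<dots> \<le> expectation (\<lambda>\<omega>. t + d * indicator {\<omega>. \<bar>Y \<omega>\<bar> > t} \<omega>)"
  proof (rule integral_mono)
    show "integrable M (\<lambda>\<omega>. \<bar>trunc d (Y \<omega>)\<bar>)"
      using assms by (intro integrable_abs integrable_trunc)
    show "integrable M (\<lambda>\<omega>. t + d * indicator {\<omega>. \<bar>Y \<omega>\<bar> > t} \<omega>)"
      using expectation_scaled_tail_indicator(2)[OF Y] by simp
    show "\<bar>trunc d (Y \<omega>)\<bar> \<le> t + d * indicator {\<omega>. \<bar>Y \<omega>\<bar> > t} \<omega>" for \<omega>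
      using abs_trunc_le[OF \<open>d > 0\<close>, of "Y \<omega>"] abs_trunc_le_abs[OF \<open>d > 0\<close>, of "Y \<omega>"] \<open>t \<ge> 0\<close>
      by (auto simp: indicator_def)
  qed
  also have "\<dots> = t + d * \<P>(\<omega> in M. \<bar>Y \<omega>\<bar> > t)"
    using expectation_scaled_tail_indicator[OF Y] by (simp add: prob_space)
  finally show ?thesis .
qed

text \<open>With \<open>Z\<close> the cutoff and \<open>Z + h\<close> the truncation, this is
  \<open>Var (Z + h) \<le> 2 Var Z + 2 Var h\<close> and \<open>Var h \<le> E h\<^sup>2\<close>. The centering constants must be split
  along with the variables, since it is \<open>Var Z\<close> and not \<open>E Z\<^sup>2\<close> that is controlled.\<close>

lemma second_moment_centered_trunc_le:
  assumes Y [measurable]: "Y \<in> borel_measurable M" and "d > 0"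
  shows "expectation (\<lambda>\<omega>. (centered_trunc M d Y \<omega>)\<^sup>2)
    \<le> 2 * variance (cutoff d Y) + 2 * d\<^sup>2 * \<P>(\<omega> in M. \<bar>Y \<omega>\<bar> > d)"
proof -
  define h where "h = (\<lambda>\<omega>. trunc d (Y \<omega>) - cutoff d Y \<omega>)"
  have [measurable]: "h \<in> borel_measurable M" unfolding h_def by measurable
  have h_sq: "(h \<omega>)\<^sup>2 = d\<^sup>2 * indicator {\<omega>. \<bar>Y \<omega>\<bar> > d} \<omega>" for \<omega>
  proof -
    have "(h \<omega>)\<^sup>2 = \<bar>h \<omega>\<bar>\<^sup>2" by simp
    also have "\<dots> = d\<^sup>2 * indicator {\<omega>. \<bar>Y \<omega>\<bar> > d} \<omega>"
      unfolding h_def abs_trunc_minus_cutoff[OF \<open>d > 0\<close>] by (auto simp: indicator_def)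
    finally show ?thesis .
  qed
  have int_h: "integrable M h"
    unfolding h_def using assms
    by (intro Bochner_Integration.integrable_diff integrable_trunc integrable_cutoff)
  have int_h_sq: "integrable M (\<lambda>\<omega>. (h \<omega>)\<^sup>2)"
    unfolding h_sq by (rule expectation_scaled_tail_indicator(2)[OF Y])
  have int_c: "integrable M (cutoff d Y)"
    using assms by (rule integrable_cutoff)
  have int_c_sq: "integrable M (\<lambda>\<omega>. (cutoff d Y \<omega>)\<^sup>2)"
    by (rule integrable_const_bound[where B = "d\<^sup>2"])
       (use \<open>d > 0\<close> abs_cutoff_le[OF \<open>d > 0\<close>, of Y] in \<open>auto simp: abs_le_square_iff[symmetric]\<close>)
  have int_dev: "integrable M (\<lambda>\<omega>. (f \<omega> - expectation f)\<^sup>2)"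
    if "integrable M f" "integrable M (\<lambda>\<omega>. (f \<omega>)\<^sup>2)" for f :: "'a \<Rightarrow> real"
    using that by (simp add: power2_diff)
  have "expectation (\<lambda>\<omega>. trunc d (Y \<omega>)) = expectation (cutoff d Y) + expectation h"
    unfolding h_def using integrable_trunc[OF assms] int_c
    by (simp add: Bochner_Integration.integral_diff)
  then have split: "centered_trunc M d Y \<omega>
      = (cutoff d Y \<omega> - expectation (cutoff d Y)) + (h \<omega> - expectation h)" for \<omega>
    by (simp add: centered_trunc_def h_def)
  have "expectation (\<lambda>\<omega>. (centered_trunc M d Y \<omega>)\<^sup>2)
      \<le> expectation (\<lambda>\<omega>. 2 * (cutoff d Y \<omega> - expectation (cutoff d Y))\<^sup>2
          + 2 * (h \<omega> - expectation h)\<^sup>2)"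
  proof (rule integral_mono')
    show "integrable M (\<lambda>\<omega>. 2 * (cutoff d Y \<omega> - expectation (cutoff d Y))\<^sup>2
          + 2 * (h \<omega> - expectation h)\<^sup>2)"
      using int_dev[OF int_c int_c_sq] int_dev[OF int_h int_h_sq] by simp
    show "(centered_trunc M d Y \<omega>)\<^sup>2 \<le> 2 * (cutoff d Y \<omega> - expectation (cutoff d Y))\<^sup>2
          + 2 * (h \<omega> - expectation h)\<^sup>2" for \<omega>
      unfolding split power2_sum
      using sum_squares_bound[of "cutoff d Y \<omega> - expectation (cutoff d Y)" "h \<omega> - expectation h"]
      by simp
  qed auto
  also have "\<dots> = 2 * variance (cutoff d Y) + 2 * variance h"
    using int_dev[OF int_c int_c_sq] int_dev[OF int_h int_h_sq] by simp
  also have "variance h \<le> expectation (\<lambda>\<omega>. (h \<omega>)\<^sup>2)"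
    by (subst variance_eq[OF int_h int_h_sq]) simp
  also have "expectation (\<lambda>\<omega>. (h \<omega>)\<^sup>2) = d\<^sup>2 * \<P>(\<omega> in M. \<bar>Y \<omega>\<bar> > d)"
    unfolding h_sq by (rule expectation_scaled_tail_indicator(1)[OF Y])
  finally show ?thesis by simp
qed

section \<open>One row of the array\<close>

lemma prob_exists_tail_le_sum:
  fixes Y :: "nat \<Rightarrow> 'a \<Rightarrow> real"
  assumes "\<And>j. j \<in> J \<Longrightarrow> Y j \<in> borel_measurable M" and "finite J"
  shows "{\<omega> \<in> space M. \<exists>j\<in>J. \<bar>Y j \<omega>\<bar> > u} \<in> sets M"
    and "\<P>(\<omega> in M. \<exists>j\<in>J. \<bar>Y j \<omega>\<bar> > u) \<le> (\<Sum>j\<in>J. \<P>(\<omega> in M. \<bar>Y j \<omega>\<bar> > u))"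
proof -
  have eq: "{\<omega> \<in> space M. \<exists>j\<in>J. \<bar>Y j \<omega>\<bar> > u} = (\<Union>j\<in>J. {\<omega> \<in> space M. \<bar>Y j \<omega>\<bar> > u})"
    by auto
  have meas: "{\<omega> \<in> space M. \<bar>Y j \<omega>\<bar> > u} \<in> sets M" if "j \<in> J" for j
    using assms(1)[OF that] by measurable
  show "{\<omega> \<in> space M. \<exists>j\<in>J. \<bar>Y j \<omega>\<bar> > u} \<in> sets M"
    unfolding eq using meas assms(2) by auto
  show "\<P>(\<omega> in M. \<exists>j\<in>J. \<bar>Y j \<omega>\<bar> > u) \<le> (\<Sum>j\<in>J. \<P>(\<omega> in M. \<bar>Y j \<omega>\<bar> > u))"
    unfolding eq using meas assms(2)
    by (intro finite_measure_subadditive_finite) auto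
qed

text \<open>If the tails of the row are small in total, every mean has modulus at most \<open>2 * u\<close>, so a
  centered truncation exceeding \<open>3 * u\<close> forces the variable itself to exceed \<open>u\<close>.\<close>

lemma prob_max_centered_trunc_le:
  fixes Y :: "nat \<Rightarrow> 'a \<Rightarrow> real"
  assumes Y: "\<And>j. j \<in> {1..m} \<Longrightarrow> Y j \<in> borel_measurable M" and "m > 0"
    and "d > 0" "u > 0" "3 * u \<le> b"
    and small: "d * (\<Sum>j=1..m. \<P>(\<omega> in M. \<bar>Y j \<omega>\<bar> > u)) \<le> u"
  shows "\<P>(\<omega> in M. (MAX j\<in>{1..m}. \<bar>centered_trunc M d (Y j) \<omega>\<bar>) > b)
    \<le> (\<Sum>j=1..m. \<P>(\<omega> in M. \<bar>Y j \<omega>\<bar> > u))"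
proof -
  have mean: "\<bar>expectation (\<lambda>\<omega>. trunc d (Y j \<omega>))\<bar> \<le> 2 * u" if j: "j \<in> {1..m}" for j
  proof -
    have "\<P>(\<omega> in M. \<bar>Y j \<omega>\<bar> > u) \<le> (\<Sum>j=1..m. \<P>(\<omega> in M. \<bar>Y j \<omega>\<bar> > u))"
      using j by (intro member_le_sum) auto
    then have "d * \<P>(\<omega> in M. \<bar>Y j \<omega>\<bar> > u) \<le> u"
      using small \<open>d > 0\<close> by (meson mult_left_mono order_trans less_imp_le)
    then show ?thesis
      using abs_expectation_trunc_le[OF Y[OF j] \<open>d > 0\<close>, of u] \<open>u > 0\<close> by linarith
  qed
  have "\<P>(\<omega> in M. (MAX j\<in>{1..m}. \<bar>centered_trunc M d (Y j) \<omega>\<bar>) > b)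
      \<le> \<P>(\<omega> in M. \<exists>j\<in>{1..m}. \<bar>Y j \<omega>\<bar> > u)"
  proof (rule finite_measure_mono)
    show "{\<omega> \<in> space M. (MAX j\<in>{1..m}. \<bar>centered_trunc M d (Y j) \<omega>\<bar>) > b}
        \<subseteq> {\<omega> \<in> space M. \<exists>j\<in>{1..m}. \<bar>Y j \<omega>\<bar> > u}"
    proof safe
      fix \<omega> assume "(MAX j\<in>{1..m}. \<bar>centered_trunc M d (Y j) \<omega>\<bar>) > b"
      then obtain j where j: "j \<in> {1..m}" "\<bar>centered_trunc M d (Y j) \<omega>\<bar> > b"
        using \<open>m > 0\<close> by (subst (asm) Max_gr_iff) auto
      have "\<bar>Y j \<omega>\<bar> > u"
        using j(2) mean[OF j(1)] abs_trunc_le_abs[OF \<open>d > 0\<close>, of "Y j \<omega>"] \<open>3 * u \<le> b\<close>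
        unfolding centered_trunc_def by linarith
      then show "\<exists>j\<in>{1..m}. \<bar>Y j \<omega>\<bar> > u" using j(1) by blast
    qed
  qed (use prob_exists_tail_le_sum(1)[OF Y] in auto)
  also have "\<dots> \<le> (\<Sum>j=1..m. \<P>(\<omega> in M. \<bar>Y j \<omega>\<bar> > u))"
    using Y by (intro prob_exists_tail_le_sum) auto
  finally show ?thesis .
qed

text \<open>Unless some variable exceeds \<open>u \<le> d\<close>, truncation changes nothing, and the partial sums
  differ from those of the centered truncations only by the deterministic differences of the
  centering constants. These add up to at most \<open>s\<close>, leaving the other half of \<open>2 * s\<close> to the
  centered truncations.\<close>

lemma prob_max_partial_sums_le:
  fixes Y :: "nat \<Rightarrow> 'a \<Rightarrow> real"
  assumes Y: "\<And>j. j \<in> {1..m} \<Longrightarrow> Y j \<in> borel_measurable M" and "m > 0"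
    and "u \<le> d" "d > 0"
    and small: "d * (\<Sum>j=1..m. \<P>(\<omega> in M. \<bar>Y j \<omega>\<bar> > u)) \<le> s"
  shows "\<P>(\<omega> in M. (MAX i\<in>{1..m}. \<bar>\<Sum>j=1..i. Y j \<omega> - expectation (cutoff d (Y j))\<bar>) > 2 * s)
    \<le> (\<Sum>j=1..m. \<P>(\<omega> in M. \<bar>Y j \<omega>\<bar> > u))
      + \<P>(\<omega> in M. (MAX i\<in>{1..m}. \<bar>\<Sum>j=1..i. centered_trunc M d (Y j) \<omega>\<bar>) \<ge> s)"
proof -
  let ?B = "{\<omega> \<in> space M. \<exists>j\<in>{1..m}. \<bar>Y j \<omega>\<bar> > u}"
  let ?C = "{\<omega> \<in> space M. (MAX i\<in>{1..m}. \<bar>\<Sum>j=1..i. centered_trunc M d (Y j) \<omega>\<bar>) \<ge> s}"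
  have meas: "(\<lambda>\<omega>. \<Sum>j=1..i. centered_trunc M d (Y j) \<omega>) \<in> borel_measurable M"
    if "i \<in> {1..m}" for i
    using Y that by (intro borel_measurable_sum measurable_centered_trunc) auto
  have C_eq: "?C = (\<Union>i\<in>{1..m}. {\<omega> \<in> space M. \<bar>\<Sum>j=1..i. centered_trunc M d (Y j) \<omega>\<bar> \<ge> s})"
    using \<open>m > 0\<close> by (auto simp: Max_ge_iff)
  have C: "?C \<in> sets M"
    unfolding C_eq using meas by (intro sets.finite_UN) auto
  have B: "?B \<in> sets M"
    using Y by (intro prob_exists_tail_le_sum) auto
  have bias: "\<bar>\<Sum>j=1..i. expectation (\<lambda>\<omega>. trunc d (Y j \<omega>)) - expectation (cutoff d (Y j))\<bar> \<le> s"
    if i: "i \<in> {1..m}" for i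
  proof -
    have "\<bar>\<Sum>j=1..i. expectation (\<lambda>\<omega>. trunc d (Y j \<omega>)) - expectation (cutoff d (Y j))\<bar>
        \<le> (\<Sum>j=1..i. d * \<P>(\<omega> in M. \<bar>Y j \<omega>\<bar> > u))"
    proof (intro order_trans[OF sum_abs] sum_mono)
      fix j assume "j \<in> {1..i}"
      then have Yj [measurable]: "Y j \<in> borel_measurable M" using i Y by auto
      have "\<P>(\<omega> in M. \<bar>Y j \<omega>\<bar> > d) \<le> \<P>(\<omega> in M. \<bar>Y j \<omega>\<bar> > u)"
        using \<open>u \<le> d\<close> by (intro finite_measure_mono) auto
      then show "\<bar>expectation (\<lambda>\<omega>. trunc d (Y j \<omega>)) - expectation (cutoff d (Y j))\<bar>
          \<le> d * \<P>(\<omega> in M. \<bar>Y j \<omega>\<bar> > u)"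
        using expectation_trunc_minus_cutoff[OF Yj \<open>d > 0\<close>] \<open>d > 0\<close>
        by (meson mult_left_mono order_trans less_imp_le)
    qed
    also have "\<dots> \<le> (\<Sum>j=1..m. d * \<P>(\<omega> in M. \<bar>Y j \<omega>\<bar> > u))"
      using i \<open>d > 0\<close> by (intro sum_mono2) auto
    finally show ?thesis using small by (simp add: sum_distrib_left)
  qed
  have "\<P>(\<omega> in M. (MAX i\<in>{1..m}. \<bar>\<Sum>j=1..i. Y j \<omega> - expectation (cutoff d (Y j))\<bar>) > 2 * s)
      \<le> prob (?B \<union> ?C)"
  proof (rule finite_measure_mono)
    show "{\<omega> \<in> space M. (MAX i\<in>{1..m}. \<bar>\<Sum>j=1..i. Y j \<omega> - expectation (cutoff d (Y j))\<bar>) > 2 * s}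
        \<subseteq> ?B \<union> ?C"
    proof
      fix \<omega>
      assume "\<omega> \<in> {\<omega> \<in> space M.
        (MAX i\<in>{1..m}. \<bar>\<Sum>j=1..i. Y j \<omega> - expectation (cutoff d (Y j))\<bar>) > 2 * s}"
      then obtain i where \<omega>: "\<omega> \<in> space M" and i: "i \<in> {1..m}"
        and big: "\<bar>\<Sum>j=1..i. Y j \<omega> - expectation (cutoff d (Y j))\<bar> > 2 * s"
        using \<open>m > 0\<close> by (auto simp: Max_gr_iff)
      show "\<omega> \<in> ?B \<union> ?C"
      proof (cases "\<omega> \<in> ?B")
        case False
        then have "trunc d (Y j \<omega>) = Y j \<omega>" if "j \<in> {1..i}" for j
          using that i \<omega> \<open>u \<le> d\<close> by (intro trunc_eq_self) force
        then have "(\<Sum>j=1..i. Y j \<omega> - expectation (cutoff d (Y j)))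
            = (\<Sum>j=1..i. centered_trunc M d (Y j) \<omega>
                + (expectation (\<lambda>\<omega>. trunc d (Y j \<omega>)) - expectation (cutoff d (Y j))))"
          by (intro sum.cong) (auto simp: centered_trunc_def)
        also have "\<dots> = (\<Sum>j=1..i. centered_trunc M d (Y j) \<omega>)
            + (\<Sum>j=1..i. expectation (\<lambda>\<omega>. trunc d (Y j \<omega>)) - expectation (cutoff d (Y j)))"
          by (rule sum.distrib)
        finally have "\<bar>\<Sum>j=1..i. centered_trunc M d (Y j) \<omega>\<bar> \<ge> s"
          using big bias[OF i] by linarith
        then show ?thesis unfolding C_eq using \<omega> i by blast
      qed simp
    qed
  qed (use B C in auto)
  also have "\<dots> \<le> prob ?B + prob ?C"
    using B C by (rule measure_Un_le)
  also have "prob ?B \<le> (\<Sum>j=1..m. \<P>(\<omega> in M. \<bar>Y j \<omega>\<bar> > u))"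
    using Y by (intro prob_exists_tail_le_sum) auto
  finally show ?thesis by simp
qed

lemma sum_second_moments_centered_trunc_le:
  fixes Y :: "nat \<Rightarrow> 'a \<Rightarrow> real"
  assumes Y: "\<And>j. j \<in> {1..m} \<Longrightarrow> Y j \<in> borel_measurable M" and "u \<le> d" "d > 0"
  shows "(\<Sum>j=1..m. expectation (\<lambda>\<omega>. (centered_trunc M d (Y j) \<omega>)\<^sup>2))
    \<le> (2 + 2 * d\<^sup>2) * ((\<Sum>j=1..m. variance (cutoff d (Y j)))
        + (\<Sum>j=1..m. \<P>(\<omega> in M. \<bar>Y j \<omega>\<bar> > u)))"
proof -
  have "expectation (\<lambda>\<omega>. (centered_trunc M d (Y j) \<omega>)\<^sup>2)
      \<le> (2 + 2 * d\<^sup>2) * (variance (cutoff d (Y j)) + \<P>(\<omega> in M. \<bar>Y j \<omega>\<bar> > u))"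
    if j: "j \<in> {1..m}" for j
  proof -
    note Yj [measurable] = Y[OF j]
    have "\<P>(\<omega> in M. \<bar>Y j \<omega>\<bar> > d) \<le> \<P>(\<omega> in M. \<bar>Y j \<omega>\<bar> > u)"
      using \<open>u \<le> d\<close> by (intro finite_measure_mono) auto
    then have "2 * d\<^sup>2 * \<P>(\<omega> in M. \<bar>Y j \<omega>\<bar> > d) \<le> (2 + 2 * d\<^sup>2) * \<P>(\<omega> in M. \<bar>Y j \<omega>\<bar> > u)"
      by (intro mult_mono) auto
    moreover have "2 * variance (cutoff d (Y j)) \<le> (2 + 2 * d\<^sup>2) * variance (cutoff d (Y j))"
      by (intro mult_right_mono) (auto intro: variance_positive)
    ultimately show ?thesis
      using second_moment_centered_trunc_le[OF Yj \<open>d > 0\<close>] by (simp only: distrib_left)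
  qed
  then show ?thesis
    unfolding sum.distrib[symmetric] sum_distrib_left by (rule sum_mono)
qed

end

section \<open>Summing over the rows\<close>

lemma powr_add_le:
  fixes x y q :: real
  assumes "x \<ge> 0" "y \<ge> 0" "q \<ge> 0"
  shows "(x + y) powr q \<le> 2 powr q * (x powr q + y powr q)"
proof -
  have "(x + y) powr q \<le> (2 * max x y) powr q"
    using assms by (intro powr_mono2) auto
  also have "\<dots> = 2 powr q * max x y powr q"
    by (rule powr_mult)
  also have "max x y powr q \<le> x powr q + y powr q"
    by (auto simp: max_def)
  finally show ?thesis by simp
qed

lemma bigo_one_nat_bounded:
  fixes f :: "nat \<Rightarrow> real"
  assumes "f \<in> O(\<lambda>_. 1)"
  shows "\<exists>A>0. \<forall>n. \<bar>f n\<bar> \<le> A"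
proof -
  obtain c where "eventually (\<lambda>n. norm (f n) \<le> c * norm (1 :: real)) at_top"
    using assms by (elim landau_o.bigE)
  then have "Bseq f"
    by (intro BfunI[where K = c]) simp
  then show ?thesis by (auto elim!: BseqE)
qed

theorem theorem2:
  fixes M :: "'a measure"
    and k :: "nat \<Rightarrow> nat"
    and X :: "nat \<Rightarrow> nat \<Rightarrow> 'a \<Rightarrow> real"
    and c \<alpha> \<beta> :: "nat \<Rightarrow> real"
    and \<delta> q :: real
  assumes "prob_space M"
    and "\<And>n. n \<ge> 1 \<Longrightarrow> k n > 0"
    and "filterlim k at_top sequentially"
    and "\<And>n j. n \<ge> 1 \<Longrightarrow> 1 \<le> j \<Longrightarrow> j \<le> k n \<Longrightarrow> X n j \<in> borel_measurable M"
    and "\<And>n. n \<ge> 1 \<Longrightarrow> c n > 0"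
    and "\<And>n. n \<ge> 1 \<Longrightarrow> \<alpha> n \<ge> 0"
    and "\<And>n. n \<ge> 1 \<Longrightarrow> \<beta> n \<ge> 0"
    and "\<alpha> \<in> O(\<lambda>_. 1)"
    and "\<beta> \<in> O(\<lambda>_. 1)"
    and "maximal_inequality M k X \<alpha> \<beta>"
    and "\<And>s. s > 0 \<Longrightarrow>
      (\<lambda>n. c n * (\<Sum>j=1..k n. \<P>(\<omega> in M. \<bar>X n j \<omega>\<bar> > s))) summable_on {1..}"
    and "\<delta> > 0"
    and "q \<ge> 1"
    and "(\<lambda>n. c n * (\<Sum>j=1..k n. prob_space.variance M (cutoff \<delta> (X n j))) powr q)
      summable_on {1..}"
  shows "\<forall>\<epsilon>>0. (\<lambda>n. c n * \<P>(\<omega> in M.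
      (MAX i\<in>{1..k n}. \<bar>\<Sum>j=1..i. X n j \<omega> - prob_space.expectation M (cutoff \<delta> (X n j))\<bar>) > \<epsilon>))
    summable_on {1..}"
proof (intro allI impI)
  fix \<epsilon> :: real assume "\<epsilon> > 0"
  interpret prob_space M by fact
  obtain A where A: "A > 0" "\<forall>n. \<bar>\<alpha> n\<bar> \<le> A"
    using bigo_one_nat_bounded[OF \<open>\<alpha> \<in> O(\<lambda>_. 1)\<close>] by blast
  obtain B where B: "B > 0" "\<forall>n. \<bar>\<beta> n\<bar> \<le> B"
    using bigo_one_nat_bounded[OF \<open>\<beta> \<in> O(\<lambda>_. 1)\<close>] by blast
  obtain C1 C2 where C: "C1 > 0" "C2 > 0"
    and M_ineq: "\<forall>n\<ge>1. \<forall>l>0. \<forall>s>0. \<forall>\<eta>>0.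
      \<P>(\<omega> in M. (MAX i\<in>{1..k n}. \<bar>\<Sum>j=1..i. centered_trunc M l (X n j) \<omega>\<bar>) \<ge> s)
      \<le> \<alpha> n * \<P>(\<omega> in M. (MAX j\<in>{1..k n}. \<bar>centered_trunc M l (X n j) \<omega>\<bar>) > C1 * \<eta>)
        + \<beta> n * ((\<Sum>j=1..k n. expectation (\<lambda>\<omega>. (centered_trunc M l (X n j) \<omega>)\<^sup>2))
                  / (C2 * s * \<eta>)) powr (s / \<eta>)"
    using \<open>maximal_inequality M k X \<alpha> \<beta>\<close> unfolding maximal_inequality_def by blast
  define s where "s = \<epsilon> / 2"
  define \<eta> where "\<eta> = s / q"
  define u where "u = min \<delta> (C1 * \<eta> / 3)"
  \<comment> \<open>below the threshold \<theta>: \<delta> * a n is at most s (for the centering constants) and at most u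
    (for the means of the truncations), and a n is at most 1, so that (a n) powr q is at most a n\<close>
  define \<theta> where "\<theta> = min 1 (min s u / \<delta>)"
  define K where "K = (2 + 2 * \<delta>\<^sup>2) / (C2 * s * \<eta>)"
  define D where "D = 1 / \<theta> + (1 + A + B * K powr q * 2 powr q)"
  define a where "a n = (\<Sum>j=1..k n. \<P>(\<omega> in M. \<bar>X n j \<omega>\<bar> > u))" for n
  define v where "v n = (\<Sum>j=1..k n. variance (cutoff \<delta> (X n j)))" for n
  define p where "p n = \<P>(\<omega> in M.
      (MAX i\<in>{1..k n}. \<bar>\<Sum>j=1..i. X n j \<omega> - expectation (cutoff \<delta> (X n j))\<bar>) > \<epsilon>)" for n
  have pos: "s > 0" "\<eta> > 0" "u > 0" "\<theta> > 0" "K > 0"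
    using \<open>\<epsilon> > 0\<close> \<open>q \<ge> 1\<close> \<open>\<delta> > 0\<close> C
    by (simp_all add: s_def \<eta>_def u_def \<theta>_def K_def add_pos_nonneg)
  have u: "u \<le> \<delta>" "3 * u \<le> C1 * \<eta>"
    by (auto simp: u_def)
  have exponent: "s / \<eta> = q"
    using pos \<open>q \<ge> 1\<close> by (simp add: \<eta>_def)
  have a_nonneg: "a n \<ge> 0" and v_nonneg: "v n \<ge> 0" for n
    by (auto simp: a_def v_def intro!: sum_nonneg variance_positive)

  have row: "p n \<le> D * (a n + v n powr q)" if n: "n \<ge> 1" for n
  proof (cases "a n > \<theta>")
    case True
    have "p n \<le> 1" by (simp add: p_def)
    also have "1 \<le> 1 / \<theta> * a n"
      using True \<open>\<theta> > 0\<close> by simp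
    also have "\<dots> \<le> D * (a n + v n powr q)"
      unfolding D_def using A(1) B(1) pos a_nonneg by (intro mult_mono) auto
    finally show ?thesis .
  next
    case False
    have meas: "X n j \<in> borel_measurable M" if "j \<in> {1..k n}" for j
      using assms(4) n that by auto
    have "k n > 0" using assms(2) n .
    have "a n \<le> 1" and "a n \<le> min s u / \<delta>"
      using False by (auto simp: \<theta>_def)
    then have small: "\<delta> * a n \<le> s" "\<delta> * a n \<le> u"
      using \<open>\<delta> > 0\<close> by (auto simp: field_simps min_def split: if_splits)
    have "p n \<le> a n
        + \<P>(\<omega> in M. (MAX i\<in>{1..k n}. \<bar>\<Sum>j=1..i. centered_trunc M \<delta> (X n j) \<omega>\<bar>) \<ge> s)"
      using prob_max_partial_sums_le[OF meas \<open>k n > 0\<close> u(1) \<open>\<delta> > 0\<close>, where s = s] small(1)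
      by (simp add: p_def a_def s_def)
    also have "\<dots> \<le> a n + (\<alpha> n * \<P>(\<omega> in M.
          (MAX j\<in>{1..k n}. \<bar>centered_trunc M \<delta> (X n j) \<omega>\<bar>) > C1 * \<eta>)
        + \<beta> n * ((\<Sum>j=1..k n. expectation (\<lambda>\<omega>. (centered_trunc M \<delta> (X n j) \<omega>)\<^sup>2))
                  / (C2 * s * \<eta>)) powr q)"
      using M_ineq[rule_format, OF n \<open>\<delta> > 0\<close> pos(1,2)] unfolding exponent by simp
    also have "\<dots> \<le> a n + (A * a n + B * (K powr q * (2 powr q * (a n + v n powr q))))"
    proof (intro add_mono mult_mono order_refl)
      show "\<alpha> n \<le> A" "\<beta> n \<le> B"
        using A(2)[rule_format, of n] B(2)[rule_format, of n] by auto
      show "\<P>(\<omega> in M. (MAX j\<in>{1..k n}. \<bar>centered_trunc M \<delta> (X n j) \<omega>\<bar>) > C1 * \<eta>) \<le> a n"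
        using prob_max_centered_trunc_le[OF meas \<open>k n > 0\<close> \<open>\<delta> > 0\<close> pos(3) u(2)] small(2)
        by (simp add: a_def)
      let ?V = "\<Sum>j=1..k n. expectation (\<lambda>\<omega>. (centered_trunc M \<delta> (X n j) \<omega>)\<^sup>2)"
      have "?V \<le> (2 + 2 * \<delta>\<^sup>2) * (v n + a n)"
        unfolding v_def a_def using meas u(1) \<open>\<delta> > 0\<close>
        by (rule sum_second_moments_centered_trunc_le)
      then have "?V / (C2 * s * \<eta>) \<le> (2 + 2 * \<delta>\<^sup>2) * (v n + a n) / (C2 * s * \<eta>)"
        using C pos by (intro divide_right_mono) auto
      then have "(?V / (C2 * s * \<eta>)) powr q \<le> (K * (v n + a n)) powr q"
        using C pos \<open>q \<ge> 1\<close> by (intro powr_mono2) (auto simp: K_def intro!: sum_nonneg divide_nonneg_nonneg)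
      also have "\<dots> = K powr q * (v n + a n) powr q"
        by (rule powr_mult)
      also have "(v n + a n) powr q \<le> 2 powr q * (v n powr q + a n powr q)"
        using a_nonneg v_nonneg \<open>q \<ge> 1\<close> by (intro powr_add_le) auto
      also have "a n powr q \<le> a n powr 1"
        using \<open>a n \<le> 1\<close> a_nonneg \<open>q \<ge> 1\<close> by (intro powr_mono') auto
      also have "a n powr 1 = a n"
        using a_nonneg by simp
      finally show "(?V / (C2 * s * \<eta>)) powr q \<le> K powr q * (2 powr q * (a n + v n powr q))"
        using pos by (simp add: add.commute)
    qed (use A B in auto)
    also have "\<dots> = (1 + A) * a n + B * K powr q * 2 powr q * (a n + v n powr q)"
      by (simp add: algebra_simps)
    also have "\<dots> \<le> (1 + A) * (a n + v n powr q) + B * K powr q * 2 powr q * (a n + v n powr q)"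
      using A(1) by simp
    also have "\<dots> = (1 + A + B * K powr q * 2 powr q) * (a n + v n powr q)"
      by (simp only: distrib_right)
    also have "\<dots> \<le> D * (a n + v n powr q)"
      unfolding D_def using pos a_nonneg by (intro mult_right_mono) auto
    finally show ?thesis .
  qed

  have "(\<lambda>n. D * (c n * a n + c n * v n powr q)) summable_on {1..}"
    unfolding a_def v_def using assms(11)[OF pos(3)] assms(14)
    by (intro summable_on_cmult_right summable_on_add)
  then have "(\<lambda>n. c n * p n) summable_on {1..}"
  proof (rule summable_on_comparison_test)
    fix n :: nat assume "n \<in> {1..}"
    then have "n \<ge> 1" by simp
    then have "c n > 0" using assms(5) by simp
    show "c n * p n \<le> D * (c n * a n + c n * v n powr q)"
      using mult_left_mono[OF row[OF \<open>n \<ge> 1\<close>] less_imp_le[OF \<open>c n > 0\<close>]]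
      by (simp add: algebra_simps)
    show "0 \<le> c n * p n" using \<open>c n > 0\<close> by (simp add: p_def)
  qed
  then show "(\<lambda>n. c n * \<P>(\<omega> in M.
      (MAX i\<in>{1..k n}. \<bar>\<Sum>j=1..i. X n j \<omega> - expectation (cutoff \<delta> (X n j))\<bar>) > \<epsilon>))
    summable_on {1..}"
    unfolding p_def .
qed

end
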